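(* For every $n\geqslant 1$, $$\sum_{\pi\in\mathfrak{S}_n^B}x^{\operatorname{des}_A(\pi)+1}y^{\operatorname{des}_B(\pi)}q^{\mathrm{neg}(\pi)}=\sum_{\sigma\in\mathcal{Q}_{n+1}^{(0)}}x^{\mathrm{lap}(\sigma)}y^{\mathrm{ap}(\sigma)}q^{\mathrm{even}(\sigma)}.$$
   Context: $\mathfrak{S}_n^B$ is the group of signed permutations $\pi=\pi(1)\cdots\pi(n)$ of $\pm[n]$; $\mathrm{neg}(\pi)$ is the number of negative entries; $\operatorname{des}_A(\pi)=\#\{i\in\{1,\ldots,n-1\}:\pi(i)>\pi(i+1)\}$; $\operatorname{des}_B(\pi)=\#\{i\in\{0,\ldots,n-1\}:\pi(i)>\pi(i+1)\}$ with $\pi(0)=0$. A Stirling permutation of a multiset is a word $\sigma$ using each element of the multiset with its multiplicity such that whenever $\sigma_i=\sigma_j$ with $i<j$, we have $\sigma_s>\sigma_i$ for all $i<s<j$. $\mathcal{Q}_{n+1}^{(0)}$ is the set of Stirling permutations $\sigma=\sigma_1\cdots\sigma_{2n+1}$ of the multiset $\{1,2,2,3,3,\ldots,n+1,n+1\}$ (the element $1$ appears once, every other element twice). Set $\sigma_0=0$. $\mathrm{lap}(\sigma)=\#\{i\in\{1,\ldots,2n\}:\sigma_{i-1}<\sigma_i=\sigma_{i+1}\}$; $\mathrm{ap}(\sigma)=\#\{i\in\{2,\ldots,2n\}:\sigma_{i-1}<\sigma_i=\sigma_{i+1}\}$; $\mathrm{even}(\sigma)$ is the number of values $v\in\{2,\ldots,n+1\}$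 whose first occurrence in $\sigma$ is at an even position. *)

theory Defs
  imports Main "HOL-Library.Multiset" "HOL-Combinatorics.Permutations"
begin

(* A signed permutation is a bijection of {-n..n} - {0} commuting with negation.
   It is represented as a function on all of int that is the identity outside that
   set, so that p 0 = 0 holds automatically, as des_B requires. *)
definition signed_perms :: "nat \<Rightarrow> (int \<Rightarrow> int) set" where
  "signed_perms n =
    {p. p permutes ({- int n..int n} - {0}) \<and> (\<forall>i. p (- i) = - p i)}"

definition neg :: "nat \<Rightarrow> (int \<Rightarrow> int) \<Rightarrow> nat" where
  "neg n p = card {i \<in> {1..int n}. p i < 0}"

definition des_A :: "nat \<Rightarrow> (int \<Rightarrow> int) \<Rightarrow> nat" where
  "des_A n p = card {i \<in> {1..int n - 1}. p i > p (i + 1)}"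

definition des_B :: "nat \<Rightarrow> (int \<Rightarrow> int) \<Rightarrow> nat" where
  "des_B n p = card {i \<in> {0..int n - 1}. p i > p (i + 1)}"

definition stirling_perms :: "nat multiset \<Rightarrow> nat list set" where
  "stirling_perms M =
    {w. mset w = M \<and>
        (\<forall>i j. i < j \<and> j < length w \<and> w ! i = w ! j \<longrightarrow> (\<forall>s. i < s \<and> s < j \<longrightarrow> w ! s > w ! i))}"

(* Q0 m is the set of Stirling permutations of {1,2,2,...,m,m}. *)
definition Q0 :: "nat \<Rightarrow> nat list set" where
  "Q0 m = stirling_perms (add_mset 1 (\<Sum>v\<in>{2..m}. {#v, v#}))"

(* letter w i is the i-th letter of w counted from 1, with letter w 0 = 0. *)
definition letter :: "nat list \<Rightarrow> nat \<Rightarrow> nat" where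
  "letter w i = (0 # w) ! i"

(* In lap, ap and even_first, n belongs to a word w of Q0 (n + 1), of length 2 * n + 1. *)
definition lap :: "nat \<Rightarrow> nat list \<Rightarrow> nat" where
  "lap n w = card {i \<in> {1..2 * n}. letter w (i - 1) < letter w i \<and> letter w i = letter w (i + 1)}"

definition ap :: "nat \<Rightarrow> nat list \<Rightarrow> nat" where
  "ap n w = card {i \<in> {2..2 * n}. letter w (i - 1) < letter w i \<and> letter w i = letter w (i + 1)}"

definition first_pos :: "nat list \<Rightarrow> nat \<Rightarrow> nat" where
  "first_pos w v = (LEAST i. 1 \<le> i \<and> letter w i = v)"

definition even_first :: "nat \<Rightarrow> nat list \<Rightarrow> nat" where
  "even_first n w = card {v \<in> {2..n + 1}. even (first_pos w v)}"

lemma signed_perms_zero: "p \<in> signed_perms n \<Longrightarrow> p 0 = 0"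
  by (auto simp: signed_perms_def permutes_def)

lemma finite_signed_perms: "finite (signed_perms n)"
  by (rule finite_subset[OF _ finite_permutations[of "{- int n..int n} - {0}"]])
     (auto simp: signed_perms_def)

lemma finite_Q0: "finite (Q0 m)"
proof -
  obtain xs :: "nat list" where xs: "mset xs = add_mset 1 (\<Sum>v\<in>{2..m}. {#v, v#})"
    using ex_mset by blast
  have "Q0 m \<subseteq> {w. mset w = mset xs}"
    by (auto simp: Q0_def stirling_perms_def xs)
  then show ?thesis
    using mset_eq_finite finite_subset by blast
qed

lemma length_Q0:
  assumes "w \<in> Q0 (n + 1)"
  shows "length w = 2 * n + 1"
proof -
  have "length w = size (add_mset 1 (\<Sum>v\<in>{2..n + 1}. {#v, v#}))"
    using assms by (metis (mono_tags, lifting) Q0_def mem_Collect_eq size_mset stirling_perms_def)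
  also have "\<dots> = 2 * n + 1"
    by (simp add: size_multiset_sum del: sum.cl_ivl_Suc)
  finally show ?thesis .
qed

end

theory Submission
  imports Defs
begin

text \<open>Both sides are built up by inserting maximal letters: \<open>\<plusminus>(n + 1)\<close> into one of the \<open>n + 1\<close> gaps
  of a signed permutation of \<open>[n]\<close>, and the adjacent pair \<open>(n + 2)(n + 2)\<close> into one of the \<open>2n + 2\<close>
  gaps of a Stirling permutation of \<open>1, 2, 2, ..., n + 1, n + 1\<close>. The pair shifts later letters
  by two, so it keeps the parities of the old first occurrences, and the gaps of odd index correspond
  to the insertion of \<open>-(n + 1)\<close>. Both insertions act on the triple of statistics by the same
  operator, and the triples agree in distribution for \<open>n = 1\<close>.\<close>

section \<open>Inserting a block into a word\<close>

definition insert_at :: "'a list \<Rightarrow> nat \<Rightarrow> 'a list \<Rightarrow> 'a list" where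
  "insert_at b j w = take j w @ b @ drop j w"

lemma insert_at_0 [simp]: "insert_at b 0 w = b @ w"
  by (simp add: insert_at_def)

lemma insert_at_Suc [simp]: "insert_at b (Suc j) (a # w) = a # insert_at b j w"
  by (simp add: insert_at_def)

lemma insert_at_Nil [simp]: "insert_at b j [] = b"
  by (simp add: insert_at_def)

lemma mset_insert_at [simp]: "mset (insert_at b j w) = mset b + mset w"
  by (metis insert_at_def append_take_drop_id mset_append add.left_commute)

text \<open>Insertion can be undone: filtering by \<open>P\<close> recovers \<open>w\<close>,
  filtering by its negation recovers \<open>b\<close>, and since \<open>b\<close> is nonempty the
  longest prefix satisfying \<open>P\<close> has length exactly \<open>j\<close>.\<close>

lemma insert_at_eqD:
  assumes eq: "insert_at b j w = insert_at b' j' w'"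
    and b: "b \<noteq> []" "b' \<noteq> []" "\<forall>x\<in>set b. \<not> P x" "\<forall>x\<in>set b'. \<not> P x"
    and w: "\<forall>x\<in>set w. P x" "\<forall>x\<in>set w'. P x"
    and j: "j \<le> length w" "j' \<le> length w'"
  shows "b = b' \<and> j = j' \<and> w = w'"
proof -
  have *: "filter P (insert_at c i v) = v \<and> filter (\<lambda>x. \<not> P x) (insert_at c i v) = c
      \<and> length (takeWhile P (insert_at c i v)) = i"
    if c: "c \<noteq> []" "\<forall>x\<in>set c. \<not> P x" and v: "\<forall>x\<in>set v. P x" and i: "i \<le> length v" for c v i
  proof -
    have t: "\<forall>x\<in>set (take i v). P x" and d: "\<forall>x\<in>set (drop i v). P x"
      using v by (auto dest: in_set_takeD in_set_dropD)
    have "filter P (take i v) = take i v" "filter P (drop i v) = drop i v" "filter P c = []"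
      using t d c by auto
    moreover have "filter (\<lambda>x. \<not> P x) (take i v) = []" "filter (\<lambda>x. \<not> P x) (drop i v) = []"
        "filter (\<lambda>x. \<not> P x) c = c"
      using t d c by auto
    moreover have "takeWhile P (insert_at c i v) = take i v"
      using t c unfolding insert_at_def by (cases c) (auto simp: takeWhile_append2)
    ultimately show ?thesis
      using i by (simp add: insert_at_def)
  qed
  show ?thesis
    using *[OF b(1,3) w(1) j(1)] *[OF b(2,4) w(2) j(2)] eq by metis
qed

section \<open>Descents and signed words\<close>

fun des :: "'a::linorder list \<Rightarrow> nat" where
  "des [] = 0"
| "des [a] = 0"
| "des (a # b # w) = (if b < a then 1 else 0) + des (b # w)"

text \<open>A maximal letter keeps the number of descents exactly in the descent gaps and at the
  right end; in any other gap it adds one. The gap before \<open>a\<close> is left out because des_A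
  and des_B react to it differently.\<close>

lemma sum_des_insert_max:
  fixes f :: "nat \<Rightarrow> 'b::comm_ring_1" and N :: "'a::linorder"
  assumes "\<forall>x\<in>set (a # w). x < N"
  shows "(\<Sum>j\<le>length w. f (des (a # insert_at [N] j w))) =
    (of_nat (des (a # w)) + 1) * f (des (a # w))
    + (of_nat (length w) - of_nat (des (a # w))) * f (Suc (des (a # w)))"
  using assms
proof (induction w arbitrary: a f)
  case Nil
  then show ?case by auto
next
  case (Cons b w)
  let ?d = "des (b # w)"
  have N: "a < N" "b < N" using Cons.prems by auto
  have first: "des (a # N # b # w) = Suc ?d" using N by auto
  show ?case
  proof (cases "b < a")
    case True
    \<comment> \<open>The descent from \<open>a\<close> to \<open>b\<close> survives insertion into
      every later gap, so the rest of the word sees the weight \<open>f\<close> shifted by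
      one.\<close>
    show ?thesis
      using Cons.IH[of b "\<lambda>k. f (Suc k)"] Cons.prems True first
      by (simp add: sum.atMost_Suc_shift algebra_simps del: sum.atMost_Suc)
  next
    case False
    show ?thesis
      using Cons.IH[of b f] Cons.prems False first
      by (simp add: sum.atMost_Suc_shift algebra_simps del: sum.atMost_Suc)
  qed
qed

text \<open>A minimal letter is neutral only in the descent gaps; unlike a maximal one it also
  creates a descent at the right end.\<close>

lemma sum_des_insert_min:
  fixes f :: "nat \<Rightarrow> 'b::comm_ring_1" and N :: "'a::linorder"
  assumes "\<forall>x\<in>set (a # w). N < x"
  shows "(\<Sum>j\<le>length w. f (des (a # insert_at [N] j w))) =
    of_nat (des (a # w)) * f (des (a # w))
    + (of_nat (length w) + 1 - of_nat (des (a # w))) * f (Suc (des (a # w)))"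
  using assms
proof (induction w arbitrary: a f)
  case Nil
  then show ?case by auto
next
  case (Cons b w)
  let ?d = "des (b # w)"
  have N: "N < a" "N < b" using Cons.prems by auto
  have first: "des (a # N # b # w) = Suc ?d" using N by auto
  show ?case
  proof (cases "b < a")
    case True
    show ?thesis
      using Cons.IH[of b "\<lambda>k. f (Suc k)"] Cons.prems True first
      by (simp add: sum.atMost_Suc_shift algebra_simps del: sum.atMost_Suc)
  next
    case False
    show ?thesis
      using Cons.IH[of b f] Cons.prems False first
      by (simp add: sum.atMost_Suc_shift algebra_simps del: sum.atMost_Suc)
  qed
qed

definition negs :: "int list \<Rightarrow> nat" where
  "negs w = length (filter (\<lambda>x. x < 0) w)"

lemma negs_insert_at [simp]: "negs (insert_at b j w) = negs b + negs w"
proof -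
  \<comment> \<open>\<open>negs\<close> depends only on the multiset of letters, and insertion adds
    multisets.\<close>
  have "negs u = size (filter_mset (\<lambda>x. x < 0) (mset u))" for u
    by (simp add: negs_def flip: size_mset mset_filter)
  then show ?thesis by simp
qed

text \<open>The triple \<open>(k, l, m)\<close> stands for \<open>(des\<^sub>A + 1, des\<^sub>B, neg)\<close> on signed permutations and
  for \<open>(lap, ap, even)\<close> on Stirling permutations; in both cases \<open>k - l \<in> {0, 1}\<close>.\<close>

definition step ::
  "nat \<Rightarrow> (nat \<Rightarrow> nat \<Rightarrow> nat \<Rightarrow> 'a::comm_ring_1) \<Rightarrow> nat \<Rightarrow> nat \<Rightarrow> nat \<Rightarrow> 'a" where
  "step n f k l m =
    (if k = l then
       f (k + 1) k m + of_nat k * f k k m + (of_nat n - of_nat k) * f (k + 1) (k + 1) m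
       + of_nat k * f k k (m + 1) + (of_nat n + 1 - of_nat k) * f (k + 1) (k + 1) (m + 1)
     else
       of_nat k * f k l m + (of_nat n + 1 - of_nat k) * f (k + 1) (l + 1) m
       + f k k (m + 1) + of_nat l * f k l (m + 1)
       + (of_nat n + 1 - of_nat k) * f (k + 1) (l + 1) (m + 1))"

text \<open>The gap in front of the word is evaluated by hand. For all other gaps the first letter
  stays in place, so the two descent counts differ by a constant and the insertion sums for a
  maximal and a minimal letter apply.\<close>

lemma sum_insert_signed:
  fixes f :: "nat \<Rightarrow> nat \<Rightarrow> nat \<Rightarrow> 'a::comm_ring_1" and w :: "int list"
  assumes w: "w \<noteq> []" and N: "\<forall>x\<in>set w. x \<noteq> 0 \<and> \<bar>x\<bar> < N"
  defines "F \<equiv> \<lambda>w. f (des w + 1) (des (0 # w)) (negs w)"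
  shows "(\<Sum>j\<le>length w. F (insert_at [N] j w)) + (\<Sum>j\<le>length w. F (insert_at [- N] j w)) =
    step (length w) f (des w + 1) (des (0 # w)) (negs w)"
proof -
  obtain a r where ar: "w = a # r" using w by (cases w) auto
  have a: "a \<noteq> 0" "\<bar>a\<bar> < N" using N ar by auto
  \<comment> \<open>\<open>e\<close> counts the descent from the leading 0 to \<open>a\<close>. Thus
    \<open>des w + 1\<close> and \<open>des (0 # w)\<close> agree iff \<open>e = 1\<close>, which is
    the case split in \<open>step\<close>.\<close>
  define e :: nat where "e = (if a < 0 then 1 else 0)"
  let ?m = "negs w"
  have negN: "negs [N] = 0" "negs [- N] = 1" using a by (auto simp: negs_def)
  have less: "\<forall>x\<in>set (a # r). x < N" and greater: "\<forall>x\<in>set (a # r). - N < x"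
    using N ar by auto
  have plus: "(\<Sum>j\<le>length r. f (Suc (des (a # insert_at [N] j r))) (e + des (a # insert_at [N] j r)) ?m)
     = (of_nat (des w) + 1) * f (Suc (des w)) (e + des w) ?m
     + (of_nat (length r) - of_nat (des w)) * f (Suc (Suc (des w))) (e + Suc (des w)) ?m"
    using sum_des_insert_max[OF less, of "\<lambda>d. f (Suc d) (e + d) ?m"] ar by simp
  have minus: "(\<Sum>j\<le>length r. f (Suc (des (a # insert_at [- N] j r))) (e + des (a # insert_at [- N] j r)) (Suc ?m))
     = of_nat (des w) * f (Suc (des w)) (e + des w) (Suc ?m)
     + (of_nat (length r) + 1 - of_nat (des w)) * f (Suc (Suc (des w))) (e + Suc (des w)) (Suc ?m)"
    using sum_des_insert_min[OF greater, of "\<lambda>d. f (Suc d) (e + d) (Suc ?m)"] ar by simp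
  have len: "length w = Suc (length r)" using ar by simp
  have des_0: "des (0 # a # u) = e + des (a # u)" for u using a by (simp add: e_def)
  have F_Suc: "F (insert_at [s] (Suc j) w) = f (Suc (des (a # insert_at [s] j r)))
      (e + des (a # insert_at [s] j r)) (negs [s] + ?m)" for s j
    using negs_insert_at[of "[s]" "Suc j" w] by (simp add: F_def ar des_0 del: des.simps negs_insert_at)
  have "negs (s # w) = negs [s] + ?m" for s
    using negs_insert_at[of "[s]" 0 w] by simp
  \<comment> \<open>In front, \<open>N\<close> creates the descent to \<open>a\<close> and none
    after the leading 0, while \<open>- N\<close> creates one after the 0 and none before
    \<open>a\<close>. In both cases \<open>e\<close> drops out.\<close>
  then have F_0: "F (insert_at [N] 0 w) = f (Suc (Suc (des w))) (Suc (des w)) ?m"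
      "F (insert_at [- N] 0 w) = f (Suc (des w)) (Suc (des w)) (Suc ?m)"
    using a negN by (auto simp: F_def ar)
  have sP: "(\<Sum>j\<le>length w. F (insert_at [N] j w)) = f (Suc (Suc (des w))) (Suc (des w)) ?m
     + (\<Sum>j\<le>length r. f (Suc (des (a # insert_at [N] j r))) (e + des (a # insert_at [N] j r)) ?m)"
    unfolding len sum.atMost_Suc_shift F_0 F_Suc negN by simp
  have sM: "(\<Sum>j\<le>length w. F (insert_at [- N] j w)) = f (Suc (des w)) (Suc (des w)) (Suc ?m)
     + (\<Sum>j\<le>length r. f (Suc (des (a # insert_at [- N] j r))) (e + des (a # insert_at [- N] j r)) (Suc ?m))"
    unfolding len sum.atMost_Suc_shift F_0 F_Suc negN by simp
  have d0: "des (0 # w) = e + des w" using ar des_0 by simp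
  show ?thesis
    unfolding sP sM plus minus d0 step_def unfolding len by (auto simp: e_def algebra_simps)
qed

section \<open>Signed permutations in window notation, and insertion of the letter of largest
  absolute value\<close>

definition signed_words :: "nat \<Rightarrow> int list set" where
  "signed_words n = {w. mset (map abs w) = mset_set {1..int n}}"

lemma mset_upto: "mset [a..b] = mset_set {a..b}"
  by (metis distinct_upto mset_set_set set_upto)

lemma signed_words_abs:
  assumes "w \<in> signed_words n"
  shows "abs ` set w = {1..int n}" "length w = n" "distinct (map abs w)"
proof -
  have m: "mset (map abs w) = mset_set {1..int n}" using assms by (simp add: signed_words_def)
  show "abs ` set w = {1..int n}"
    using arg_cong[OF m, of set_mset] by simp
  then show "length w = n"
    using arg_cong[OF m, of size] by simp
  show "distinct (map abs w)"
    using mset_eq_imp_distinct_iff[of "map abs w" "[1..int n]"] m by (simp add: mset_upto)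
qed

lemma mset_set_Suc_int: "mset_set {1..int (Suc n)} = add_mset (int (Suc n)) (mset_set {1..int n})"
proof -
  have "{1..int (Suc n)} = insert (int (Suc n)) {1..int n}" by auto
  then show ?thesis by simp
qed

text \<open>The inverse map deletes the only letter of absolute value \<open>n + 1\<close> and
  remembers its sign and its position.\<close>

lemma bij_signed_words_insert:
  "bij_betw (\<lambda>(s, w, j). insert_at [s] j w)
     ({int (Suc n), - int (Suc n)} \<times> signed_words n \<times> {..n}) (signed_words (Suc n))"
  (is "bij_betw ?F ?D _")
proof (rule bij_betw_imageI)
  let ?N = "int (Suc n)"
  have lt: "\<forall>x\<in>set w. \<bar>x\<bar> < ?N" if "w \<in> signed_words n" for w
  proof
    fix x assume "x \<in> set w"
    then have "\<bar>x\<bar> \<in> {1..int n}" using signed_words_abs(1)[OF that] by blast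
    then show "\<bar>x\<bar> < ?N" by simp
  qed
  show "inj_on ?F ?D"
  proof (rule inj_onI, clarsimp simp del: of_nat_Suc)
    fix s s' w w' j j'
    assume s: "s = ?N \<or> s = - ?N" "s' = ?N \<or> s' = - ?N"
      and w: "w \<in> signed_words n" "w' \<in> signed_words n" and j: "j \<le> n" "j' \<le> n"
      and eq: "insert_at [s] j w = insert_at [s'] j' w'"
    have "[s] = [s'] \<and> j = j' \<and> w = w'"
      using eq
      by (rule insert_at_eqD[where P = "\<lambda>x. \<bar>x\<bar> < ?N"])
         (use s w j lt signed_words_abs(2) in auto)
    then show "s = s' \<and> w = w' \<and> j = j'" by simp
  qed
  show "?F ` ?D = signed_words (Suc n)"
  proof
    show "?F ` ?D \<subseteq> signed_words (Suc n)"
      by (auto simp: signed_words_def mset_set_Suc_int simp del: of_nat_Suc)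
    show "signed_words (Suc n) \<subseteq> ?F ` ?D"
    proof
      fix v assume v: "v \<in> signed_words (Suc n)"
      then have "?N \<in> abs ` set v" using signed_words_abs(1)[OF v] by simp
      then obtain s where s: "s \<in> set v" "\<bar>s\<bar> = ?N" by auto
      then obtain u r where v_eq: "v = u @ s # r" using split_list by metis
      have "u @ r \<in> signed_words n"
        using v s unfolding signed_words_def v_eq by (simp add: mset_set_Suc_int del: of_nat_Suc)
      moreover from this have "length u \<le> n"
        using signed_words_abs(2) by fastforce
      moreover have "v = insert_at [s] (length u) (u @ r)"
        by (simp add: v_eq insert_at_def)
      moreover have "s = ?N \<or> s = - ?N" using s by linarith
      ultimately show "v \<in> ?F ` ?D" by force
    qed
  qed
qed

lemma sum_signed_words_Suc:
  fixes f :: "nat \<Rightarrow> nat \<Rightarrow> nat \<Rightarrow> 'a::comm_ring_1"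
  assumes "n \<ge> 1"
  shows "(\<Sum>w\<in>signed_words (Suc n). f (des w + 1) (des (0 # w)) (negs w)) =
    (\<Sum>w\<in>signed_words n. step n f (des w + 1) (des (0 # w)) (negs w))"
proof -
  let ?N = "int (Suc n)" and ?F = "\<lambda>w. f (des w + 1) (des (0 # w)) (negs w)"
  have "(\<Sum>w\<in>signed_words (Suc n). ?F w) =
      (\<Sum>(s, w, j)\<in>{?N, - ?N} \<times> signed_words n \<times> {..n}. ?F (insert_at [s] j w))"
    by (subst sum.reindex_bij_betw[OF bij_signed_words_insert, symmetric]) (simp add: case_prod_unfold)
  also have "\<dots> = (\<Sum>s\<in>{?N, - ?N}. \<Sum>w\<in>signed_words n. \<Sum>j\<le>n. ?F (insert_at [s] j w))"
    by (simp add: sum.cartesian_product del: of_nat_Suc)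
  also have "\<dots> = (\<Sum>w\<in>signed_words n. (\<Sum>j\<le>n. ?F (insert_at [?N] j w)) + (\<Sum>j\<le>n. ?F (insert_at [- ?N] j w)))"
    by (simp add: sum.distrib)
  also have "\<dots> = (\<Sum>w\<in>signed_words n. step n f (des w + 1) (des (0 # w)) (negs w))"
  proof (rule sum.cong[OF refl])
    fix w assume w: "w \<in> signed_words n"
    have "x \<noteq> 0 \<and> \<bar>x\<bar> < ?N" if "x \<in> set w" for x
    proof -
      have "\<bar>x\<bar> \<in> {1..int n}" using signed_words_abs(1)[OF w] that by blast
      then show ?thesis by auto
    qed
    moreover have "w \<noteq> []" "length w = n" using signed_words_abs(2)[OF w] assms by auto
    ultimately show "(\<Sum>j\<le>n. ?F (insert_at [?N] j w)) + (\<Sum>j\<le>n. ?F (insert_at [- ?N] j w)) =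
        step n f (des w + 1) (des (0 # w)) (negs w)"
      using sum_insert_signed[of w ?N f] by simp
  qed
  finally show ?thesis .
qed

section \<open>Transfer between signed permutations and their windows\<close>

lemma des_map_upto:
  "des (map p [a..b]) = card {i \<in> {a..b - 1}. p i > (p (i + 1) :: 'a::linorder)}"
proof (induction a b rule: upto.induct)
  case (1 a b)
  show ?case
  proof (cases "a < b")
    case False
    then show ?thesis by (cases "a = b") auto
  next
    case True
    let ?S = "{i \<in> {a + 1..b - 1}. p i > p (i + 1)}"
    have upto: "[a..b] = a # (a + 1) # [a + 1 + 1..b]" "[a + 1..b] = (a + 1) # [a + 1 + 1..b]"
      using True by (auto simp: upto_rec1)
    have "finite ?S"
      by (rule finite_subset[of _ "{a + 1..b - 1}"]) auto
    then have card: "card (insert a ?S) = 1 + card ?S"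
      by (subst card_insert_disjoint) auto
    have "des (map p [a..b]) = (if p (a + 1) < p a then 1 else 0) + des (map p [a + 1..b])"
      unfolding upto by simp
    also have "\<dots> = (if p (a + 1) < p a then 1 else 0) + card ?S"
      using 1 True by simp
    also have "\<dots> = card (if p (a + 1) < p a then insert a ?S else ?S)"
      by (simp only: card add_0 split: if_split) simp
    also have "(if p (a + 1) < p a then insert a ?S else ?S) = {i \<in> {a..b - 1}. p i > p (i + 1)}"
      using True by (auto simp: order_le_less)
    finally show ?thesis .
  qed
qed

lemma negs_map_upto: "negs (map p [1..int n]) = neg n p"
proof -
  have "negs (map p [1..int n]) = length (filter (\<lambda>i. p i < 0) [1..int n])"
    by (simp add: negs_def filter_map o_def)
  also have "\<dots> = card ({i. p i < 0} \<inter> {1..int n})"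
    by (subst distinct_length_filter) auto
  also have "{i. p i < 0} \<inter> {1..int n} = {i \<in> {1..int n}. p i < 0}" by auto
  finally show ?thesis by (simp add: neg_def)
qed

text \<open>An odd map is determined by its values on the positive indices, and every window extends
  to an odd bijection.\<close>

lemma bij_signed_perms_words:
  "bij_betw (\<lambda>p. map p [1..int n]) (signed_perms n) (signed_words n)"
proof (rule bij_betw_imageI)
  let ?S = "{- int n..int n} - {0}"
  show "inj_on (\<lambda>p. map p [1..int n]) (signed_perms n)"
  proof (rule inj_onI, rule ext)
    fix p p' i
    assume p: "p \<in> signed_perms n" and p': "p' \<in> signed_perms n"
      and "map p [1..int n] = map p' [1..int n]"
    then have eq: "p k = p' k" if "k \<in> {1..int n}" for k using that by simp
    have odd: "p (- k) = - p k" "p' (- k) = - p' k" for k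
      using p p' by (auto simp: signed_perms_def)
    consider "i \<notin> ?S" | "i \<in> {1..int n}" | "- i \<in> {1..int n}" by force
    then show "p i = p' i"
    proof cases
      case 1
      then show ?thesis using p p' by (auto simp: signed_perms_def permutes_def)
    next
      case 3
      then show ?thesis using eq[of "- i"] odd[of i] by simp
    qed (rule eq)
  qed
  show "(\<lambda>p. map p [1..int n]) ` signed_perms n = signed_words n"
  proof
    show "(\<lambda>p. map p [1..int n]) ` signed_perms n \<subseteq> signed_words n"
    proof clarify
      fix p assume p: "p \<in> signed_perms n"
      then have perm: "p permutes ?S" and odd: "\<And>k. p (- k) = - p k"
        by (auto simp: signed_perms_def)
      have inj: "inj_on (\<lambda>i. \<bar>p i\<bar>) {1..int n}"
      proof (rule inj_onI)
        fix i j assume ij: "i \<in> {1..int n}" "j \<in> {1..int n}" "\<bar>p i\<bar> = \<bar>p j\<bar>"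
        \<comment> \<open>By oddness, equal absolute values mean
          \<open>p i = p (\<plusminus>j)\<close>, so injectivity of \<open>p\<close> leaves only the
          index \<open>j\<close> or \<open>- j\<close>, and positivity rules out the latter.\<close>
        then have "p i = p j \<or> p i = p (- j)" using odd[of j] by linarith
        then have "i = j \<or> i = - j" using permutes_inj[OF perm] by (auto dest: injD)
        then show "i = j" using ij by auto
      qed
      have "\<bar>p i\<bar> \<in> {1..int n}" if "i \<in> {1..int n}" for i
        using that permutes_in_image[OF perm, of i] by auto
      then have "(\<lambda>i. \<bar>p i\<bar>) ` {1..int n} = {1..int n}"
        using inj by (intro endo_inj_surj) auto
      then have "image_mset (\<lambda>i. \<bar>p i\<bar>) (mset_set {1..int n}) = mset_set {1..int n}"
        using inj by (simp add: image_mset_mset_set)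
      then show "map p [1..int n] \<in> signed_words n"
        by (simp add: signed_words_def mset_upto multiset.map_comp o_def)
    qed
    show "signed_words n \<subseteq> (\<lambda>p. map p [1..int n]) ` signed_perms n"
    proof
      fix w assume w: "w \<in> signed_words n"
      note W = signed_words_abs[OF w]
      \<comment> \<open>The odd extension of the window: the factor \<open>sgn i\<close> handles
        negative indices, and the shift by one occurs because list positions start at 0.\<close>
      define p where "p i = (if i \<in> ?S then sgn i * w ! nat (\<bar>i\<bar> - 1) else i)" for i
      have abs_p: "\<bar>p i\<bar> = map abs w ! nat (\<bar>i\<bar> - 1)" "nat (\<bar>i\<bar> - 1) < length w" if "i \<in> ?S" for i
      proof -
        show l: "nat (\<bar>i\<bar> - 1) < length w" using that W(2) by auto
        have "\<bar>p i\<bar> = \<bar>w ! nat (\<bar>i\<bar> - 1)\<bar>"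
          using that by (simp add: p_def abs_mult abs_sgn_eq)
        also have "\<dots> = map abs w ! nat (\<bar>i\<bar> - 1)"
          by (rule nth_map[OF l, symmetric])
        finally show "\<bar>p i\<bar> = map abs w ! nat (\<bar>i\<bar> - 1)" .
      qed
      have range: "\<bar>p i\<bar> \<in> {1..int n}" if "i \<in> ?S" for i
      proof -
        have "\<bar>p i\<bar> \<in> set (map abs w)" using abs_p[OF that] by (metis nth_mem length_map)
        then show ?thesis using W(1) by simp
      qed
      have odd: "p (- i) = - p i" for i
        by (auto simp: p_def)
      have "inj_on p ?S"
      proof (rule inj_onI)
        fix i j assume ij: "i \<in> ?S" "j \<in> ?S" "p i = p j"
        then have "map abs w ! nat (\<bar>i\<bar> - 1) = map abs w ! nat (\<bar>j\<bar> - 1)" using abs_p by metis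
        then have "nat (\<bar>i\<bar> - 1) = nat (\<bar>j\<bar> - 1)"
          using W(3) abs_p(2)[OF ij(1)] abs_p(2)[OF ij(2)] by (simp add: distinct_conv_nth) metis
        then have "\<bar>i\<bar> = \<bar>j\<bar>" using ij by auto
        then have "i = j \<or> i = - j" by linarith
        \<comment> \<open>If \<open>i = - j\<close>, then \<open>p i = - p j = - p i\<close> would
          force \<open>p i = 0\<close>.\<close>
        moreover have "p i \<noteq> 0" using range[OF ij(1)] by auto
        ultimately show "i = j" using odd[of j] ij(3) by auto
      qed
      moreover have "p ` ?S \<subseteq> ?S" using range by fastforce
      ultimately have "bij_betw p ?S ?S"
        by (intro bij_betw_imageI endo_inj_surj) auto
      then have "p permutes ?S" by (rule bij_imp_permutes) (auto simp: p_def)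
      then have "p \<in> signed_perms n" using odd by (simp add: signed_perms_def)
      moreover have "map p [1..int n] = w"
      proof (rule nth_equalityI)
        show "length (map p [1..int n]) = length w" using W(2) by simp
        fix k assume "k < length (map p [1..int n])"
        then show "map p [1..int n] ! k = w ! k" by (simp add: p_def)
      qed
      ultimately show "w \<in> (\<lambda>p. map p [1..int n]) ` signed_perms n" by blast
    qed
  qed
qed

lemma sum_signed_perms:
  "(\<Sum>p\<in>signed_perms n. f (des_A n p + 1) (des_B n p) (neg n p)) =
   (\<Sum>w\<in>signed_words n. f (des w + 1) (des (0 # w)) (negs w))"
proof (subst sum.reindex_bij_betw[OF bij_signed_perms_words, symmetric], rule sum.cong[OF refl])
  fix p assume "p \<in> signed_perms n"
  \<comment> \<open>As \<open>p 0 = 0\<close>, the leading 0 is the value at index 0; hence the same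
    count over an interval gives des_A from index 1 and des_B from index 0.\<close>
  then have "0 # map p [1..int n] = map p [0..int n]"
    by (simp add: signed_perms_zero upto_rec1)
  then have "des (0 # map p [1..int n]) = des_B n p"
    by (simp add: des_map_upto des_B_def)
  then show "f (des_A n p + 1) (des_B n p) (neg n p) = f (des (map p [1..int n]) + 1)
      (des (0 # map p [1..int n])) (negs (map p [1..int n]))"
    by (simp add: negs_map_upto des_map_upto des_A_def)
qed

section \<open>Ascent plateaus and Stirling permutations\<close>

text \<open>The first argument is the letter preceding the word. With 0 in front of the whole word
  this will be lap; with the first letter in front of the tail it will be ap, which ignores position
  1.\<close>

fun plateaus :: "nat \<Rightarrow> nat list \<Rightarrow> nat" where
  "plateaus p [] = 0"
| "plateaus p [a] = 0"
| "plateaus p (a # b # w) = (if p < a \<and> a = b then 1 else 0) + plateaus a (b # w)"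

text \<open>If \<open>i\<close> is an ascent plateau, a pair of maximal letters put into the gap before or after
  position \<open>i\<close> destroys it and creates a new one. These two gaps have different parities, and the
  gaps of different plateaus are disjoint.\<close>

lemma sum_plateaus_insert:
  fixes g :: "bool \<Rightarrow> nat \<Rightarrow> 'a::comm_ring_1"
  assumes "p < N" "\<forall>x\<in>set w. x < N"
  shows "(\<Sum>j\<le>length w. g (even j) (plateaus p (insert_at [N, N] j w))) =
    of_nat (plateaus p w) * (g True (plateaus p w) + g False (plateaus p w))
    + (of_nat (length w div 2) + 1 - of_nat (plateaus p w)) * g True (Suc (plateaus p w))
    + (of_nat (Suc (length w) div 2) - of_nat (plateaus p w)) * g False (Suc (plateaus p w))"
  using assms
\<comment> \<open>Induction on the length, since a plateau at the front removes two letters at once.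
  The weight \<open>g\<close> varies so that it can absorb a shift of the count or a flip of the
  parity.\<close>
proof (induction w arbitrary: p g rule: length_induct)
  case (1 w)
  have IH: "(\<Sum>j\<le>length v. h (even j) (plateaus c (insert_at [N, N] j v))) =
      of_nat (plateaus c v) * (h True (plateaus c v) + h False (plateaus c v))
      + (of_nat (length v div 2) + 1 - of_nat (plateaus c v)) * h True (Suc (plateaus c v))
      + (of_nat (Suc (length v) div 2) - of_nat (plateaus c v)) * h False (Suc (plateaus c v))"
    if "length v < length w" "c < N" "\<forall>x\<in>set v. x < N" for v c and h :: "bool \<Rightarrow> nat \<Rightarrow> 'a"
    using 1(1) that by blast
  show ?case
  proof (cases "(p, w)" rule: plateaus.cases)
    case (1 q)
    then show ?thesis using "1.prems" by simp
  next
    case (2 q a)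
    then show ?thesis using "1.prems" by auto
  next
    case (3 q a b r)
    then have w: "w = a # b # r" by simp
    have lt: "a < N" "b < N" "\<forall>x\<in>set r. x < N" "\<forall>x\<in>set (b # r). x < N"
      using "1.prems" w by auto
    show ?thesis
    proof (cases "p < a \<and> a = b")
      case True
      \<comment> \<open>The gaps 0 and 1 break the plateau \<open>a b\<close> and create a new one:
        a letter preceded by a larger or equal one starts no plateau. Later gaps keep it, and their
        indices drop by two, so parities are kept.\<close>
      have N: "plateaus N (b # r) = plateaus b r"
        using lt by (cases r) auto
      have b: "plateaus b (b # u) = plateaus b u" for u
        by (cases u) auto
      show ?thesis
        using IH[of r b "\<lambda>e k. g e (Suc k)"] True lt "1.prems"
        by (simp add: w sum.atMost_Suc_shift N b algebra_simps del: sum.atMost_Suc)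
    next
      case False
      \<comment> \<open>No plateau arises at \<open>a\<close>, whichever letter comes to follow it.
        Removing \<open>a\<close> lowers the gap indices by one, hence the negated parity in the
        induction hypothesis.\<close>
      have "plateaus p (a # insert_at [N, N] j (b # r)) = plateaus a (insert_at [N, N] j (b # r))" for j
        using False lt by (cases j) auto
      moreover have "plateaus p w = plateaus a (b # r)" "plateaus N w = plateaus a (b # r)"
        using False lt by (auto simp: w)
      moreover have "plateaus p (N # N # w) = Suc (plateaus N w)"
        using lt "1.prems" by (simp add: w)
      ultimately show ?thesis
        using IH[of "b # r" a "\<lambda>e. g (\<not> e)"] lt
        unfolding w length_Cons sum.atMost_Suc_shift[of _ "Suc (length r)"]
        by (simp add: algebra_simps del: plateaus.simps sum.atMost_Suc)
    qed
  qed
qed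

text \<open>lap and ap differ, by one, exactly if the word opens with a double letter, whose plateau
  only lap counts. This is the case split in \<open>step\<close>.\<close>

lemma sum_insert_stirling:
  fixes f :: "nat \<Rightarrow> nat \<Rightarrow> nat \<Rightarrow> 'a::comm_ring_1"
  assumes len: "length w = 2 * n + 1" and N: "\<forall>x\<in>set w. 0 < x \<and> x < N"
  shows "(\<Sum>j\<le>2 * n + 1. f (plateaus 0 (insert_at [N, N] j w))
      (plateaus (hd (insert_at [N, N] j w)) (tl (insert_at [N, N] j w))) (if odd j then Suc m else m)) =
    step n f (plateaus 0 w) (plateaus (hd w) (tl w)) m"
proof -
  obtain a r where w: "w = a # r" using len by (cases w) auto
  have r: "length r = 2 * n" and lt: "0 < a" "a < N" "\<forall>x\<in>set r. x < N"
    using len N w by auto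
  have N_w: "plateaus N (a # r) = plateaus a r"
    using lt by (cases r) auto
  have l: "2 * n + 1 = Suc (length r)" using r by simp
  show ?thesis
  proof (cases "\<exists>r'. r = a # r'")
    case True
    then obtain r' where r': "r = a # r'" by blast
    obtain n' where n': "n = Suc n'" using r r' by (cases n) auto
    have len': "length r' = 2 * n' + 1" using r r' n' by simp
    have N_r: "plateaus N (a # r') = plateaus a r'"
      using lt r' by (cases r') auto
    have a: "plateaus a (a # u) = plateaus a u" for u
      by (cases u) auto
    have lt': "\<forall>x\<in>set r'. x < N" using lt r' by simp
    \<comment> \<open>Later insertions keep the opening plateau, hence \<open>Suc k\<close> for lap.
      Two letters are removed, so \<open>\<not> e\<close> marks the odd gaps. Gap 1 yields the term
      \<open>f k k (m + 1)\<close> of \<open>step\<close>: the opening plateau is replaced by one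
      that ap counts too.\<close>
    show ?thesis
      using sum_plateaus_insert[OF lt(2) lt', of "\<lambda>e k. f (Suc k) k (if \<not> e then Suc m else m)"]
        lt(1,2) N_w N_r
      unfolding l w r' length_Cons sum.atMost_Suc_shift
      by (simp add: a len' n' step_def algebra_simps del: sum.atMost_Suc)
  next
    case False
    have first: "plateaus 0 (a # insert_at [N, N] j r) = plateaus a (insert_at [N, N] j r)" for j
      using False lt by (cases j; cases r) auto
    have w0: "plateaus 0 (a # r) = plateaus a r"
      using False lt by (cases r) auto
    \<comment> \<open>A gap of \<open>r\<close> lies one place further right in \<open>w\<close>, so
      here \<open>e\<close> marks the odd gaps. Gap 0 yields \<open>f (k + 1) k m\<close>, since
      only lap counts a pair at the front.\<close>
    show ?thesis
      using sum_plateaus_insert[OF lt(2,3), of "\<lambda>e k. f k k (if e then Suc m else m)"]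
        lt(1,2) N_w
      unfolding l w sum.atMost_Suc_shift
      by (simp add: first w0 r step_def algebra_simps del: sum.atMost_Suc)
  qed
qed

section \<open>The Stirling condition as a recursion on lists\<close>

fun guarded :: "'a::linorder \<Rightarrow> 'a list \<Rightarrow> bool" where
  "guarded a [] = True"
| "guarded a (b # w) = ((a \<in> set w \<longrightarrow> a < b) \<and> guarded a w)"

text \<open>\<open>guarded a w\<close> covers the pairs of equal letters whose left member is an
  \<open>a\<close> placed directly before \<open>w\<close>.\<close>

fun stirling :: "'a::linorder list \<Rightarrow> bool" where
  "stirling [] = True"
| "stirling (a # w) = (guarded a w \<and> stirling w)"

lemma all_nat_split: "(\<forall>i::nat. P i) \<longleftrightarrow> P 0 \<and> (\<forall>i. P (Suc i))"
  by (metis not0_implies_Suc)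

lemma guarded_iff:
  "guarded a w \<longleftrightarrow> (\<forall>j s. s < j \<and> j < length w \<and> w ! j = a \<longrightarrow> a < w ! s)"
proof (induction w)
  case (Cons b w)
  have "(\<forall>j s. s < j \<and> j < length (b # w) \<and> (b # w) ! j = a \<longrightarrow> a < (b # w) ! s) \<longleftrightarrow>
      (\<forall>j<length w. w ! j = a \<longrightarrow> a < b) \<and> (\<forall>j s. s < j \<and> j < length w \<and> w ! j = a \<longrightarrow> a < w ! s)"
    by (subst all_nat_split, subst (2) all_nat_split) auto
  then show ?case using Cons by (auto simp: in_set_conv_nth)
qed simp

text \<open>Pairs with left index 0 are governed by \<open>guarded\<close>; all others are pairs of
  the tail.\<close>

lemma stirling_iff:
  "stirling w \<longleftrightarrow>
    (\<forall>i j. i < j \<and> j < length w \<and> w ! i = w ! j \<longrightarrow> (\<forall>s. i < s \<and> s < j \<longrightarrow> w ! s > w ! i))"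
  (is "_ \<longleftrightarrow> ?P w")
proof (induction w)
  case (Cons a w)
  have "?P (a # w) \<longleftrightarrow> (\<forall>j. j < length w \<and> a = w ! j \<longrightarrow> (\<forall>s. s < j \<longrightarrow> w ! s > a)) \<and> ?P w"
  proof
    assume P: "?P (a # w)"
    have "\<forall>j. j < length w \<and> a = w ! j \<longrightarrow> (\<forall>s. s < j \<longrightarrow> w ! s > a)"
    proof (intro allI impI)
      fix j s assume "j < length w \<and> a = w ! j" "s < j"
      then show "w ! s > a" using P[rule_format, of 0 "Suc j" "Suc s"] by simp
    qed
    moreover have "?P w"
    proof (intro allI impI)
      fix i j s assume "i < j \<and> j < length w \<and> w ! i = w ! j" "i < s \<and> s < j"
      then show "w ! s > w ! i" using P[rule_format, of "Suc i" "Suc j" "Suc s"] by simp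
    qed
    ultimately show "(\<forall>j. j < length w \<and> a = w ! j \<longrightarrow> (\<forall>s. s < j \<longrightarrow> w ! s > a)) \<and> ?P w" ..
  next
    assume P: "(\<forall>j. j < length w \<and> a = w ! j \<longrightarrow> (\<forall>s. s < j \<longrightarrow> w ! s > a)) \<and> ?P w"
    show "?P (a # w)"
    proof (intro allI impI)
      fix i j s
      assume ij: "i < j \<and> j < length (a # w) \<and> (a # w) ! i = (a # w) ! j" and s: "i < s \<and> s < j"
      obtain j' s' where js: "j = Suc j'" "s = Suc s'" using ij s by (cases j; cases s) auto
      show "(a # w) ! s > (a # w) ! i"
      proof (cases i)
        case 0
        then show ?thesis using P ij s js by auto
      next
        case (Suc i')
        then show ?thesis
          using P[THEN conjunct2, rule_format, of i' j' s'] ij s js by simp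
      qed
    qed
  qed
  then show ?case using Cons by (auto simp: guarded_iff)
qed simp

section \<open>Inserting and removing the pair of largest letters\<close>

lemma guarded_insert_pair:
  "a < N \<Longrightarrow> guarded a (u @ N # N # v) \<longleftrightarrow> guarded a (u @ v)"
  by (induction u) auto

lemma guarded_notin: "a \<notin> set w \<Longrightarrow> guarded a w"
  by (induction w) auto

text \<open>Nothing stands between the two new letters, and between equal old letters they are large
  enough to be harmless.\<close>

lemma stirling_insert_pair:
  "\<forall>x\<in>set (u @ v). x < N \<Longrightarrow> stirling (u @ N # N # v) \<longleftrightarrow> stirling (u @ v)"
  by (induction u) (auto simp: guarded_insert_pair intro!: guarded_notin)

text \<open>A letter between the two copies of the maximum would have to exceed it, so the copies
  are adjacent.\<close>

lemma stirling_max_pair: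
  assumes "stirling w" "count (mset w) N = 2" "\<forall>x\<in>set w. x \<le> N"
  obtains u v where "w = u @ N # N # v"
proof -
  have "N \<in> set w" using assms(2) by (metis count_mset_0_iff zero_neq_numeral)
  then obtain u r where w: "w = u @ N # r" and u: "N \<notin> set u"
    using split_list_first by metis
  have "stirling (N # r)" using assms(1) unfolding w by (induction u) auto
  then have r: "guarded N r" by simp
  have "count (mset u) N = 0" using u by (metis count_mset_0_iff)
  moreover have "count (mset w) N = Suc (count (mset u) N + count (mset r) N)" by (simp add: w)
  ultimately have "count (mset r) N = 1" using assms(2) by linarith
  then have "N \<in> set r" by (metis count_mset_0_iff zero_neq_one)
  then obtain b v where bv: "r = b # v" by (cases r) auto
  have "b \<le> N" using assms(3) by (simp add: w bv)
  \<comment> \<open>Otherwise the second \<open>N\<close> lies in \<open>v\<close>, and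
    \<open>guarded\<close> would demand \<open>N < b\<close>.\<close>
  then have "b = N" using \<open>N \<in> set r\<close> r by (auto simp: bv)
  then show ?thesis using that w bv by simp
qed

definition letters :: "nat \<Rightarrow> nat multiset" where
  "letters m = add_mset 1 (\<Sum>v\<in>{2..m}. {#v, v#})"

lemma Q0_altdef: "Q0 m = {w. mset w = letters m \<and> stirling w}"
  unfolding Q0_def stirling_perms_def letters_def stirling_iff ..

lemma letters_Suc: "letters (Suc (Suc n)) = {#Suc (Suc n), Suc (Suc n)#} + letters (Suc n)"
  by (simp add: letters_def)

lemma set_letters: "set_mset (letters (Suc n)) = {1..Suc n}"
proof (induction n)
  case (Suc n)
  then show ?case by (auto simp: letters_Suc)
qed (simp add: letters_def)

lemma set_Q0: "w \<in> Q0 (n + 1) \<Longrightarrow> set w = {1..n + 1}"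
  using set_letters[of n] by (simp add: Q0_altdef flip: set_mset_mset)

text \<open>The inverse deletes the two largest letters, which are adjacent by
  \<open>stirling_max_pair\<close>; \<open>stirling_insert_pair\<close> preserves the Stirling
  condition in both directions.\<close>

lemma bij_Q0_insert:
  "bij_betw (\<lambda>(w, j). insert_at [n + 2, n + 2] j w) (Q0 (n + 1) \<times> {..2 * n + 1}) (Q0 (n + 2))"
  (is "bij_betw ?F ?D _")
proof (rule bij_betw_imageI)
  let ?N = "n + 2"
  have lt: "\<forall>x\<in>set w. x < ?N" if "w \<in> Q0 (n + 1)" for w
    using set_Q0[OF that] by auto
  show "inj_on ?F ?D"
  proof (rule inj_onI, clarify)
    fix w w' j j'
    assume w: "w \<in> Q0 (n + 1)" "w' \<in> Q0 (n + 1)" and j: "j \<le> 2 * n + 1" "j' \<le> 2 * n + 1"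
      and eq: "insert_at [?N, ?N] j w = insert_at [?N, ?N] j' w'"
    have "[?N, ?N] = [?N, ?N] \<and> j = j' \<and> w = w'"
      using eq
      by (rule insert_at_eqD[where P = "\<lambda>x. x < ?N"])
         (use w j lt length_Q0 in auto)
    then show "w = w' \<and> j = j'" by simp
  qed
  show "?F ` ?D = Q0 ?N"
  proof
    show "?F ` ?D \<subseteq> Q0 ?N"
    proof clarify
      fix w j assume w: "w \<in> Q0 (n + 1)"
      have "stirling (insert_at [?N, ?N] j w)"
        using stirling_insert_pair[of "take j w" "drop j w" ?N] lt[OF w] w
        by (simp add: insert_at_def Q0_altdef)
      then show "insert_at [?N, ?N] j w \<in> Q0 ?N"
        using w by (simp add: Q0_altdef letters_Suc)
    qed
    show "Q0 ?N \<subseteq> ?F ` ?D"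
    proof
      fix w assume w: "w \<in> Q0 ?N"
      have m: "mset w = {#?N, ?N#} + letters (n + 1)"
        using w by (simp add: Q0_altdef letters_Suc)
      have "?N \<notin># letters (n + 1)" using set_letters[of n] by simp
      then have "count (mset w) ?N = 2" by (simp add: m not_in_iff)
      moreover have "\<forall>x\<in>set w. x \<le> ?N" using set_Q0[of w "n + 1"] w by auto
      moreover have st: "stirling w" using w by (simp add: Q0_altdef)
      ultimately obtain u v where uv: "w = u @ ?N # ?N # v"
        using stirling_max_pair by blast
      have muv: "mset (u @ v) = letters (n + 1)" using m by (simp add: uv)
      then have "set (u @ v) = {1..n + 1}" using set_letters[of n] by (metis Suc_eq_plus1 set_mset_mset)
      then have "\<forall>x\<in>set (u @ v). x < ?N" by auto
      then have "u @ v \<in> Q0 (n + 1)"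
        using st muv stirling_insert_pair[of u v ?N] by (simp add: uv Q0_altdef)
      moreover from length_Q0[OF this] have "length u \<le> 2 * n + 1" by simp
      moreover have "w = insert_at [?N, ?N] (length u) (u @ v)"
        by (simp add: uv insert_at_def)
      ultimately show "w \<in> ?F ` ?D" by force
    qed
  qed
qed

text \<open>Trades the minimum for a prefix length, which can be followed through an
  insertion.\<close>

lemma first_pos_eq:
  assumes "v \<in> set w"
  shows "first_pos w v = Suc (length (takeWhile (\<lambda>x. x \<noteq> v) w))"
  unfolding first_pos_def
proof (rule Least_equality)
  let ?k = "length (takeWhile (\<lambda>x. x \<noteq> v) w)"
  have "takeWhile (\<lambda>x. x \<noteq> v) w \<noteq> w" using assms by (auto simp: takeWhile_eq_all_conv)
  then have "?k < length w"
    by (metis takeWhile_eq_take take_all length_takeWhile_le nat_less_le order_refl)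
  then show "1 \<le> Suc ?k \<and> letter w (Suc ?k) = v"
    using nth_length_takeWhile[of "\<lambda>x. x \<noteq> v" w] by (simp add: letter_def)
next
  fix i assume i: "1 \<le> i \<and> letter w i = v"
  then obtain i' where i': "i = Suc i'" "w ! i' = v" by (cases i) (auto simp: letter_def)
  show "Suc (length (takeWhile (\<lambda>x. x \<noteq> v) w)) \<le> i"
  proof (rule ccontr)
    assume "\<not> ?thesis"
    then have "i' < length (takeWhile (\<lambda>x. x \<noteq> v) w)" using i' by simp
    from nth_mem[OF this] takeWhile_nth[OF this] have "w ! i' \<in> set (takeWhile (\<lambda>x. x \<noteq> v) w)"
      by simp
    then show False using i' by (auto dest: set_takeWhileD)
  qed
qed

text \<open>Old first occurrences move by 0 or 2 places, and the new letter first occurs at position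
  \<open>j + 1\<close>.\<close>

lemma even_first_insert:
  assumes w: "w \<in> Q0 (n + 1)" and j: "j \<le> 2 * n + 1"
  shows "even_first (Suc n) (insert_at [n + 2, n + 2] j w) =
    (if odd j then Suc (even_first n w) else even_first n w)"
proof -
  let ?N = "n + 2"
  let ?w = "insert_at [?N, ?N] j w"
  have set_w: "set w = {1..n + 1}" by (rule set_Q0[OF w])
  have parity: "even (first_pos ?w v) = even (first_pos w v)" if v: "v \<in> {2..n + 1}" for v
  proof -
    \<comment> \<open>Splitting \<open>w\<close> at the gap lets both prefix lengths be compared
      piece by piece, according to whether \<open>v\<close> occurs before the gap.\<close>
    have in_w: "v \<in> set (take j w @ drop j w)" using v set_w by simp
    have "v \<in> set ?w" using in_w by (auto simp: insert_at_def simp del: append_take_drop_id)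
    moreover have "v \<noteq> ?N" using v by auto
    ultimately have "even (length (takeWhile (\<lambda>x. x \<noteq> v) ?w))
        = even (length (takeWhile (\<lambda>x. x \<noteq> v) (take j w @ drop j w)))"
      unfolding insert_at_def
      by (cases "v \<in> set (take j w)") (auto simp: takeWhile_append simp del: append_take_drop_id)
    then show ?thesis
      using \<open>v \<in> set ?w\<close> in_w by (simp add: first_pos_eq)
  qed
  have "?N \<notin> set (take j w)" using set_w by (auto dest: in_set_takeD)
  then have "length (takeWhile (\<lambda>x. x \<noteq> ?N) ?w) = j"
    using j length_Q0[OF w] by (subst insert_at_def, subst takeWhile_append2) auto
  moreover have "?N \<in> set ?w" by (simp add: insert_at_def)
  ultimately have N: "first_pos ?w ?N = Suc j" by (simp add: first_pos_eq)
  let ?E = "{v \<in> {2..n + 1}. even (first_pos w v)}"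
  have "{v \<in> {2..?N}. even (first_pos ?w v)} = (if odd j then insert ?N ?E else ?E)"
    (is "?L = ?R")
  proof (rule set_eqI)
    fix v
    have "v \<in> {2..?N} \<longleftrightarrow> v = ?N \<or> v \<in> {2..n + 1}" by auto
    then show "v \<in> ?L \<longleftrightarrow> v \<in> ?R" using parity N by auto
  qed
  moreover have "finite ?E" "?N \<notin> ?E" by auto
  ultimately show ?thesis by (simp add: even_first_def)
qed

lemma sum_Q0_Suc:
  fixes f :: "nat \<Rightarrow> nat \<Rightarrow> nat \<Rightarrow> 'a::comm_ring_1"
  shows "(\<Sum>w\<in>Q0 (n + 2). f (plateaus 0 w) (plateaus (hd w) (tl w)) (even_first (Suc n) w)) =
    (\<Sum>w\<in>Q0 (n + 1). step n f (plateaus 0 w) (plateaus (hd w) (tl w)) (even_first n w))"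
proof -
  let ?N = "n + 2"
  let ?F = "\<lambda>w m. f (plateaus 0 w) (plateaus (hd w) (tl w)) m"
  have "(\<Sum>w\<in>Q0 (n + 2). ?F w (even_first (Suc n) w)) =
      (\<Sum>(w, j)\<in>Q0 (n + 1) \<times> {..2 * n + 1}.
        ?F (insert_at [?N, ?N] j w) (even_first (Suc n) (insert_at [?N, ?N] j w)))"
    by (subst sum.reindex_bij_betw[OF bij_Q0_insert, symmetric]) (simp only: case_prod_unfold)
  also have "\<dots> = (\<Sum>w\<in>Q0 (n + 1). \<Sum>j\<le>2 * n + 1.
        ?F (insert_at [?N, ?N] j w) (even_first (Suc n) (insert_at [?N, ?N] j w)))"
    by (rule sum.cartesian_product[symmetric])
  also have "\<dots> = (\<Sum>w\<in>Q0 (n + 1). \<Sum>j\<le>2 * n + 1.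
        ?F (insert_at [?N, ?N] j w) (if odd j then Suc (even_first n w) else even_first n w))"
    by (intro sum.cong refl) (simp only: even_first_insert atMost_iff)
  also have "\<dots> = (\<Sum>w\<in>Q0 (n + 1). step n f (plateaus 0 w) (plateaus (hd w) (tl w)) (even_first n w))"
  proof (intro sum.cong refl sum_insert_stirling)
    fix w assume w: "w \<in> Q0 (n + 1)"
    show "length w = 2 * n + 1" by (rule length_Q0[OF w])
    show "\<forall>x\<in>set w. 0 < x \<and> x < ?N" using set_Q0[OF w] by auto
  qed
  finally show ?thesis .
qed

section \<open>lap and ap as plateau counts, and the comparison of both sides\<close>

lemma plateaus_eq_card:
  "plateaus p w = card {i \<in> {..<length w - 1}. (p # w) ! i < w ! i \<and> w ! i = w ! Suc i}"
proof -
  \<comment> \<open>Splitting off the first summand reproduces the recursion; truncated subtraction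
    makes the range empty for the empty word.\<close>
  have "plateaus p w =
      (\<Sum>i<length w - 1. if (p # w) ! i < w ! i \<and> w ! i = w ! Suc i then 1 else 0)"
    by (induction p w rule: plateaus.induct) (auto simp: sum.lessThan_Suc_shift simp del: sum.lessThan_Suc)
  then show ?thesis by (simp add: sum.If_cases Int_def)
qed

lemma lap_eq_plateaus:
  assumes "length w = 2 * n + 1"
  shows "lap n w = plateaus 0 w"
proof -
  have "{i \<in> {1..2 * n}. letter w (i - 1) < letter w i \<and> letter w i = letter w (i + 1)}
      = Suc ` {i \<in> {..<length w - 1}. (0 # w) ! i < w ! i \<and> w ! i = w ! Suc i}" (is "?L = Suc ` ?R")
  proof (rule set_eqI)
    fix i show "i \<in> ?L \<longleftrightarrow> i \<in> Suc ` ?R"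
      using assms by (cases i) (auto simp: letter_def)
  qed
  then show ?thesis
    unfolding lap_def plateaus_eq_card by (simp only: card_image inj_Suc)
qed

text \<open>Index 0 of the tail is position 2 of the word, hence the double shift by
  \<open>Suc\<close>.\<close>

lemma ap_eq_plateaus:
  assumes "length w = 2 * n + 1"
  shows "ap n w = plateaus (hd w) (tl w)"
proof -
  obtain a r where w: "w = a # r" using assms by (cases w) auto
  have "{i \<in> {2..2 * n}. letter w (i - 1) < letter w i \<and> letter w i = letter w (i + 1)}
      = Suc ` Suc ` {i \<in> {..<length r - 1}. (a # r) ! i < r ! i \<and> r ! i = r ! Suc i}"
    (is "?L = Suc ` Suc ` ?R")
  proof (rule set_eqI)
    fix i
    consider "i = 0" | "i = 1" | k where "i = Suc (Suc k)" by (cases i rule: nat.exhaust; force simp: neq0_conv gr0_conv_Suc)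
    then show "i \<in> ?L \<longleftrightarrow> i \<in> Suc ` Suc ` ?R"
      using assms by cases (auto simp: letter_def w)
  qed
  then show ?thesis
    unfolding ap_def plateaus_eq_card by (simp only: card_image inj_Suc w list.sel)
qed

text \<open>Both families satisfy the same recursion through \<open>step\<close>. The weight
  \<open>f\<close> is arbitrary so that the induction hypothesis can be used for
  \<open>step (Suc n) f\<close>.\<close>

lemma sum_signed_words_eq_sum_Q0:
  fixes f :: "nat \<Rightarrow> nat \<Rightarrow> nat \<Rightarrow> 'a::comm_ring_1"
  shows "(\<Sum>w\<in>signed_words (Suc n). f (des w + 1) (des (0 # w)) (negs w)) =
    (\<Sum>w\<in>Q0 (n + 2). f (plateaus 0 w) (plateaus (hd w) (tl w)) (even_first (Suc n) w))"
proof (induction n arbitrary: f)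
  case 0
  have "w = [1] \<or> w = [- 1]" if w: "w \<in> signed_words (Suc 0)" for w
  proof -
    obtain s where "w = [s]"
      using signed_words_abs(2)[OF w] by (auto simp: length_Suc_conv)
    then show ?thesis using w by (auto simp: signed_words_def)
  qed
  then have "signed_words (Suc 0) = {[1], [- 1]}"
    by (auto simp: signed_words_def)
  moreover have "Q0 1 = {[1]}"
    by (auto simp: Q0_altdef letters_def)
  \<comment> \<open>One step from the single word \<open>[1]\<close> gives
    \<open>f 1 0 0 + f 1 1 1\<close>, the weights of the signed words \<open>[1]\<close> and
    \<open>[- 1]\<close>.\<close>
  ultimately show ?case
    using sum_Q0_Suc[of f 0] by (simp add: negs_def step_def even_first_def)
next
  case (Suc n)
  have "(\<Sum>w\<in>signed_words (Suc (Suc n)). f (des w + 1) (des (0 # w)) (negs w)) =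
      (\<Sum>w\<in>signed_words (Suc n). step (Suc n) f (des w + 1) (des (0 # w)) (negs w))"
    by (rule sum_signed_words_Suc) simp
  also have "\<dots> = (\<Sum>w\<in>Q0 (Suc n + 1). step (Suc n) f (plateaus 0 w) (plateaus (hd w) (tl w))
      (even_first (Suc n) w))"
    using Suc[of "step (Suc n) f"] by simp
  also have "\<dots> = (\<Sum>w\<in>Q0 (Suc n + 2). f (plateaus 0 w) (plateaus (hd w) (tl w))
      (even_first (Suc (Suc n)) w))"
    by (rule sum_Q0_Suc[symmetric])
  finally show ?case .
qed

theorem theorem3:
  fixes n :: nat and x y q :: "'a::comm_ring_1"
  assumes "n \<ge> 1"
  shows "(\<Sum>p\<in>signed_perms n. x ^ (des_A n p + 1) * y ^ des_B n p * q ^ neg n p) =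
         (\<Sum>w\<in>Q0 (n + 1). x ^ lap n w * y ^ ap n w * q ^ even_first n w)"
proof -
  \<comment> \<open>The equality of sums holds for every weight; the generating polynomials come
    from this monomial.\<close>
  define f where "f k l m = x ^ k * y ^ l * q ^ m" for k l m
  obtain n' where n': "n = Suc n'" using assms by (cases n) auto
  have "(\<Sum>p\<in>signed_perms n. f (des_A n p + 1) (des_B n p) (neg n p)) =
      (\<Sum>w\<in>signed_words n. f (des w + 1) (des (0 # w)) (negs w))"
    by (rule sum_signed_perms)
  also have "\<dots> = (\<Sum>w\<in>Q0 (n + 1). f (plateaus 0 w) (plateaus (hd w) (tl w)) (even_first n w))"
    using sum_signed_words_eq_sum_Q0[of f n'] by (simp add: n')
  also have "\<dots> = (\<Sum>w\<in>Q0 (n + 1). f (lap n w) (ap n w) (even_first n w))"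
    by (intro sum.cong refl) (simp only: lap_eq_plateaus ap_eq_plateaus length_Q0)
  finally show ?thesis by (simp only: f_def)
qed

end
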